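(* If $(E,\mathrm{dep})$ is a DSC, then $\mathsf{rdp}(E)$ is a finite diamond-free semimodular lattice. Conversely, every finite diamond-free semimodular lattice is isomorphic to $\mathsf{rdp}(E)$ for some DSC $(E,\mathrm{dep})$.
   Context: $P(A)$ denotes the power set of $A$. A preDSC is a pair $(E,\mathrm{dep})$ with $E$ a finite set and $\mathrm{dep}:E\to P(P(E))$ a function; elements of $\mathrm{dep}(e)$ are called depsets of $e$. For $X,Y\subseteq E$ write $X\,\mathrm{rch}\,Y$ if $X\subseteq Y$ and for every $y\in Y$ there is $D\in\mathrm{dep}(y)$ with $D\subseteq X$. A subset $X\subseteq E$ is reachable if there is a finite sequence of subsets with $\varnothing\,\mathrm{rch}\,X_0\,\mathrm{rch}\cdots\mathrm{rch}\,X_n\,\mathrm{rch}\,X$. $\mathsf{rdp}(E)$ is the poset of reachable subsets ordered by inclusion. A subset $X$ is complete if every $e\in X$ has a depset $D\in\mathrm{dep}(e)$ with $D\subseteq X$. A DSC is a preDSC which is irredundant ($D_0\subseteq D_1$ with $D_0,D_1\in\mathrm{dep}(e)$ implies $D_0=D_1$), acyclic ($e\notin D$ for all $D\in\mathrm{dep}(e)$), nonsingular ($\mathrm{dep}(e)\neq\varnothing$ for all $e$) and has complete depsets (all $D\in\mathrm{dep}(e)$ are complete). In a lattice, $x\prec y$ means $x<y$ and there is no $z$ with $x<z<y$. A lattice is (upper) semimodular if $a\wedge b\prec a$ implies $b\prec a\vee b$. It is diamond-free semimodular if it is semimodular and has no sublattice (subset closed under binary meets and joins) isomorphic to the diamond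 lattice $M_3=\{\bot,a,b,c,\top\}$, in which $a,b,c$ are pairwise incomparable, each strictly between $\bot$ and $\top$. *)

theory Defs
  imports "HOL-Algebra.Lattice"
begin

section \<open>Lattices\<close>

text \<open>
  The locale \<^locale>\<open>lattice\<close> allows an empty carrier; lattices here are nonempty.
\<close>

definition finite_lattice :: "('a, 'c) gorder_scheme \<Rightarrow> bool" where
  "finite_lattice L \<longleftrightarrow> lattice L \<and> finite (carrier L) \<and> carrier L \<noteq> {}"

definition covered_by :: "('a, 'c) gorder_scheme \<Rightarrow> 'a \<Rightarrow> 'a \<Rightarrow> bool" where
  "covered_by L x y \<longleftrightarrow>
     x \<in> carrier L \<and> y \<in> carrier L \<and> x \<sqsubset>\<^bsub>L\<^esub> y \<and>
     \<not> (\<exists>z \<in> carrier L. x \<sqsubset>\<^bsub>L\<^esub> z \<and> z \<sqsubset>\<^bsub>L\<^esub> y)"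

definition semimodular :: "('a, 'c) gorder_scheme \<Rightarrow> bool" where
  "semimodular L \<longleftrightarrow>
     (\<forall>a \<in> carrier L. \<forall>b \<in> carrier L.
        covered_by L (a \<sqinter>\<^bsub>L\<^esub> b) a \<longrightarrow> covered_by L b (a \<squnion>\<^bsub>L\<^esub> b))"

definition sublattice :: "('a, 'c) gorder_scheme \<Rightarrow> 'a set \<Rightarrow> bool" where
  "sublattice L S \<longleftrightarrow>
     S \<subseteq> carrier L \<and>
     (\<forall>x \<in> S. \<forall>y \<in> S. x \<sqinter>\<^bsub>L\<^esub> y \<in> S \<and> x \<squnion>\<^bsub>L\<^esub> y \<in> S)"

text \<open>
  Isomorphism of posets. For lattices, and for sublattices with the induced order, this is the
  same as lattice isomorphism, since the order determines meets and joins.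
\<close>

definition order_isomorphic ::
    "('a, 'c) gorder_scheme \<Rightarrow> ('b, 'd) gorder_scheme \<Rightarrow> bool" where
  "order_isomorphic A B \<longleftrightarrow>
     (\<exists>f. bij_betw f (carrier A) (carrier B) \<and> order_emb A B f)"

datatype diamond = Bot | Atom_a | Atom_b | Atom_c | Top

definition M3 :: "diamond gorder" where
  "M3 = \<lparr>carrier = UNIV, eq = (=), le = (\<lambda>x y. x = y \<or> x = Bot \<or> y = Top)\<rparr>"

definition diamond_free_semimodular :: "('a, 'c) gorder_scheme \<Rightarrow> bool" where
  "diamond_free_semimodular L \<longleftrightarrow>
     semimodular L \<and>
     \<not> (\<exists>S. sublattice L S \<and> order_isomorphic (L\<lparr>carrier := S\<rparr>) M3)"


section \<open>Dependency structures with choice\<close>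

text \<open>
  The function \<open>dep\<close> is total on the ambient type; its values outside \<open>E\<close> are irrelevant.
\<close>

locale preDSC =
  fixes E :: "'e set" and dep :: "'e \<Rightarrow> 'e set set"
  assumes finite_E: "finite E"
    and dep_subset: "e \<in> E \<Longrightarrow> dep e \<subseteq> Pow E"

definition complete_subset :: "'e set \<Rightarrow> ('e \<Rightarrow> 'e set set) \<Rightarrow> 'e set \<Rightarrow> bool" where
  "complete_subset E dep X \<longleftrightarrow> X \<subseteq> E \<and> (\<forall>e \<in> X. \<exists>D \<in> dep e. D \<subseteq> X)"

locale DSC = preDSC +
  assumes irredundant:
      "\<lbrakk>e \<in> E; D0 \<in> dep e; D1 \<in> dep e; D0 \<subseteq> D1\<rbrakk> \<Longrightarrow> D0 = D1"
    and acyclic: "\<lbrakk>e \<in> E; D \<in> dep e\<rbrakk> \<Longrightarrow> e \<notin> D"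
    and nonsingular: "e \<in> E \<Longrightarrow> dep e \<noteq> {}"
    and complete_depsets: "\<lbrakk>e \<in> E; D \<in> dep e\<rbrakk> \<Longrightarrow> complete_subset E dep D"

definition rch :: "'e set \<Rightarrow> ('e \<Rightarrow> 'e set set) \<Rightarrow> 'e set \<Rightarrow> 'e set \<Rightarrow> bool" where
  "rch E dep X Y \<longleftrightarrow>
     X \<subseteq> E \<and> Y \<subseteq> E \<and> X \<subseteq> Y \<and> (\<forall>y \<in> Y. \<exists>D \<in> dep y. D \<subseteq> X)"

definition reachable :: "'e set \<Rightarrow> ('e \<Rightarrow> 'e set set) \<Rightarrow> 'e set \<Rightarrow> bool" where
  "reachable E dep X \<longleftrightarrow>
     (\<exists>(n :: nat) Xs. rch E dep {} (Xs 0) \<and>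
        (\<forall>i < n. rch E dep (Xs i) (Xs (Suc i))) \<and>
        rch E dep (Xs n) X)"

definition rdp :: "'e set \<Rightarrow> ('e \<Rightarrow> 'e set set) \<Rightarrow> 'e set gorder" where
  "rdp E dep = \<lparr>carrier = {X. reachable E dep X}, eq = (=), le = (\<subseteq>)\<rparr>"

end

theory Submission
  imports Defs
begin

text \<open>
  Both directions pass through antimatroids: union-closed families of subsets of a finite ground
  set \<open>E\<close> that cover \<open>E\<close> and in which every nonempty member can lose some element and stay in the
  family. The members are called feasible.

  In a DSC the reachable sets are exactly the complete sets (\<open>reachable_iff_complete\<close>), and these
  form an antimatroid: choose inside a complete set \<open>X\<close> a maximal proper complete subset \<open>Y\<close>;
  a minimal complete subset of \<open>X\<close> not contained in \<open>Y\<close> contains an element with a depset inside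
  \<open>Y\<close>, so that adding this element to \<open>Y\<close> already gives \<open>X\<close>. In the lattice of feasible sets, joins are
  unions and covers add a single element, which gives semimodularity. If \<open>A\<close>, \<open>B\<close>, \<open>C\<close> had a common
  pairwise join and a strictly smaller common pairwise meet \<open>R\<close>, then \<open>R\<close> could be enlarged
  inside \<open>A\<close> by one element \<open>e\<close>; as \<open>A \<subseteq> B \<union> C\<close>, the larger set would lie in \<open>A \<inter> B\<close> or in
  \<open>A \<inter> C\<close>, hence below \<open>R\<close>.

  For the converse, send an element \<open>x\<close> of the lattice to the set of meet-irreducible elements that
  are not above \<open>x\<close>. This is an order embedding that turns joins into unions, and its image is an
  antimatroid as soon as each cover \<open>y \<prec> x\<close> is separated by exactly one meet-irreducible \<open>m\<close>, that
  is, \<open>y \<sqsubseteq> m\<close> but not \<open>x \<sqsubseteq> m\<close>. Uniqueness is the heart of the proof. It rests on \<open>join_avoids\<close>, an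
  instance of meet-semidistributivity: the elements above \<open>y\<close> but not above \<open>x\<close> are closed under
  joins. Its critical case is three covers \<open>x\<close>, \<open>a\<close>, \<open>b\<close> of \<open>y\<close>, which would span a diamond if
  \<open>x \<sqsubseteq> a \<squnion> b\<close>. Finally, an antimatroid is the family of complete sets of the DSC in which the depsets
  of \<open>e\<close> are the minimal feasible sets to which \<open>e\<close> can be added (\<open>complete_depsets_iff\<close>).
\<close>

section \<open>Diamonds as five-element configurations\<close>

text \<open>
  Three elements with a common pairwise meet and a different common pairwise join are automatically
  distinct and incomparable: a single comparability would already collapse all five elements.
  This first-order form is easier to establish and to refute than the existence of a sublattice.
\<close>

lemma (in lattice) diamond_sublattice_iff:
  "(\<exists>S. sublattice L S \<and> order_isomorphic (L\<lparr>carrier := S\<rparr>) M3) \<longleftrightarrow>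
   (\<exists>a\<in>carrier L. \<exists>b\<in>carrier L. \<exists>c\<in>carrier L. \<exists>p q. p \<noteq> q \<and>
      a \<sqinter> b = p \<and> a \<sqinter> c = p \<and> b \<sqinter> c = p \<and> a \<squnion> b = q \<and> a \<squnion> c = q \<and> b \<squnion> c = q)"
    (is "?lhs \<longleftrightarrow> ?rhs")
proof
  assume ?lhs
  then obtain S f where S: "sublattice L S" and bij: "bij_betw f S UNIV"
    and emb: "order_emb (L\<lparr>carrier := S\<rparr>) M3 f"
    by (auto simp: order_isomorphic_def M3_def)
  have SL: "S \<subseteq> carrier L"
    and Sm: "\<And>x y. x \<in> S \<Longrightarrow> y \<in> S \<Longrightarrow> x \<sqinter> y \<in> S"
    and Sj: "\<And>x y. x \<in> S \<Longrightarrow> y \<in> S \<Longrightarrow> x \<squnion> y \<in> S"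
    using S by (auto simp: sublattice_def)
  have le: "x \<sqsubseteq> y \<longleftrightarrow> f x = f y \<or> f x = Bot \<or> f y = Top" if "x \<in> S" "y \<in> S" for x y
    using emb that by (auto simp: order_emb_def M3_def)
  have inj: "f x = f y \<longleftrightarrow> x = y" if "x \<in> S" "y \<in> S" for x y
    using bij that by (auto simp: bij_betw_def inj_on_def)
  have surj: "\<exists>x\<in>S. f x = d" for d
    using bij by (metis UNIV_I bij_betw_def image_iff)
  obtain a where a: "a \<in> S" "f a = Atom_a" using surj by blast
  obtain b where b: "b \<in> S" "f b = Atom_b" using surj by blast
  obtain c where c: "c \<in> S" "f c = Atom_c" using surj by blast
  obtain p where p: "p \<in> S" "f p = Bot" using surj by blast
  obtain q where q: "q \<in> S" "f q = Top" using surj by blast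
  have meet: "x \<sqinter> y = p" if "x \<in> S" "y \<in> S" "f x \<noteq> f y" "f x \<noteq> Top" "f y \<noteq> Top" for x y
  proof -
    have "f (x \<sqinter> y) = Bot"
      using le[of "x \<sqinter> y" x] le[of "x \<sqinter> y" y] meet_left[of x y] meet_right[of x y]
        that SL Sm[of x y] by auto
    then show ?thesis using inj[of "x \<sqinter> y" p] p Sm that by auto
  qed
  have join: "x \<squnion> y = q" if "x \<in> S" "y \<in> S" "f x \<noteq> f y" "f x \<noteq> Bot" "f y \<noteq> Bot" for x y
  proof -
    have "f (x \<squnion> y) = Top"
      using le[of x "x \<squnion> y"] le[of y "x \<squnion> y"] join_left[of x y] join_right[of x y]
        that SL Sj[of x y] by auto
    then show ?thesis using inj[of "x \<squnion> y" q] q Sj that by auto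
  qed
  have "p \<noteq> q" using p q by auto
  then show ?rhs
    using a b c SL by (intro bexI[of _ a] bexI[of _ b] bexI[of _ c] exI[of _ p] exI[of _ q])
      (auto simp: meet join)
next
  assume ?rhs
  then obtain a b c p q where car: "a \<in> carrier L" "b \<in> carrier L" "c \<in> carrier L"
    and "p \<noteq> q" and m: "a \<sqinter> b = p" "a \<sqinter> c = p" "b \<sqinter> c = p"
    and j: "a \<squnion> b = q" "a \<squnion> c = q" "b \<squnion> c = q" by blast
  have cpq: "p \<in> carrier L" "q \<in> carrier L" using m(1) j(1) car by auto
  have lm: "x \<sqsubseteq> y \<longleftrightarrow> x \<sqinter> y = x" "x \<sqsubseteq> y \<longleftrightarrow> x \<squnion> y = y"
    if "x \<in> carrier L" "y \<in> carrier L" for x y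
    using le_iff_join le_iff_meet that by auto
  have below: "p \<sqsubseteq> a" "p \<sqsubseteq> b" "p \<sqsubseteq> c" "a \<sqsubseteq> q" "b \<sqsubseteq> q" "c \<sqsubseteq> q"
    using m j car meet_left meet_right join_left join_right by metis+
  then have pq: "p \<sqsubseteq> q" using le_trans car cpq by blast
  note comm = meet_comm[of L] join_comm[of L]
  have nle: "\<not> a \<sqsubseteq> b" "\<not> a \<sqsubseteq> c" "\<not> b \<sqsubseteq> a" "\<not> b \<sqsubseteq> c" "\<not> c \<sqsubseteq> a" "\<not> c \<sqsubseteq> b"
    using lm car m j \<open>p \<noteq> q\<close> comm by metis+
  have ne: "a \<noteq> p" "b \<noteq> p" "c \<noteq> p" "a \<noteq> q" "b \<noteq> q" "c \<noteq> q"
    using nle below by metis+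
  have ne': "a \<noteq> b" "a \<noteq> c" "b \<noteq> c" using nle car by auto
  define S where "S = {p, a, b, c, q}"
  have SL: "S \<subseteq> carrier L" using car cpq by (auto simp: S_def)
  have idem: "x \<sqinter> x = x" "x \<squnion> x = x" if "x \<in> carrier L" for x
    using lm[of x x] that by auto
  have tab: "p \<sqinter> x = p" "x \<sqinter> p = p" "p \<squnion> x = x" "x \<squnion> p = x"
    "q \<sqinter> x = x" "x \<sqinter> q = x" "q \<squnion> x = q" "x \<squnion> q = q" if "x \<in> S" for x
  proof -
    have "p \<sqsubseteq> x" "x \<sqsubseteq> q" "x \<in> carrier L" using that below pq cpq SL by (auto simp: S_def)
    then show "p \<sqinter> x = p" "x \<sqinter> p = p" "p \<squnion> x = x" "x \<squnion> p = x"
    "q \<sqinter> x = x" "x \<sqinter> q = x" "q \<squnion> x = q" "x \<squnion> q = q"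
      using lm cpq comm by metis+
  qed
  have m': "b \<sqinter> a = p" "c \<sqinter> a = p" "c \<sqinter> b = p" and j': "b \<squnion> a = q" "c \<squnion> a = q" "c \<squnion> b = q"
    using m j comm by metis+
  have "x \<sqinter> y \<in> S \<and> x \<squnion> y \<in> S" if "x \<in> S" "y \<in> S" for x y
  proof (cases "x \<in> {p, q} \<or> y \<in> {p, q}")
    case True
    then show ?thesis using tab that by auto
  next
    case False
    then have "x \<in> {a, b, c}" "y \<in> {a, b, c}" using that by (auto simp: S_def)
    then show ?thesis using m j m' j' idem car by (auto simp: S_def)
  qed
  then have sub: "sublattice L S" using SL by (auto simp: sublattice_def)
  define f where "f x = (if x = p then Bot else if x = a then Atom_a else if x = b then Atom_b
     else if x = c then Atom_c else Top)" for x
  have f: "f p = Bot" "f a = Atom_a" "f b = Atom_b" "f c = Atom_c" "f q = Top"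
    using ne ne' \<open>p \<noteq> q\<close> by (auto simp: f_def)
  have "bij_betw f S UNIV"
  proof (intro bij_betwI')
    show "f x = f y \<longleftrightarrow> x = y" if "x \<in> S" "y \<in> S" for x y
      using that f by (auto simp: S_def)
    show "\<exists>x\<in>S. d = f x" for d
      by (cases d) (auto simp: S_def f)
  qed simp
  moreover have "x \<sqsubseteq> y \<longleftrightarrow> f x = f y \<or> f x = Bot \<or> f y = Top" if "x \<in> S" "y \<in> S" for x y
  proof -
    have "\<not> q \<sqsubseteq> x" if "x \<in> {p, a, b, c}" for x
      using that below pq ne \<open>p \<noteq> q\<close> le_antisym car cpq by auto
    moreover have "\<not> x \<sqsubseteq> p" if "x \<in> {a, b, c, q}" for x
      using that below pq ne \<open>p \<noteq> q\<close> le_antisym[of p x] car cpq by auto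
    ultimately show ?thesis
      using that f below pq nle car cpq by (auto simp: S_def)
  qed
  moreover have "weak_partial_order M3"
    by unfold_locales (auto simp: M3_def)
  ultimately have "order_isomorphic (L\<lparr>carrier := S\<rparr>) M3"
    using weak_partial_order_subset[OF weak_partial_order_axioms SL]
    by (auto simp: order_isomorphic_def order_emb_def M3_def intro!: exI[of _ f])
  with sub show ?lhs by blast
qed

section \<open>Antimatroids and their lattices of feasible sets\<close>

locale antimatroid =
  fixes E :: "'e set" and F :: "'e set set"
  assumes finite_ground: "finite E"
    and Union_feasible: "\<Union>F = E"
    and empty_feasible: "{} \<in> F"
    and union_feasible: "\<lbrakk>X \<in> F; Y \<in> F\<rbrakk> \<Longrightarrow> X \<union> Y \<in> F"
    and accessible: "\<lbrakk>X \<in> F; X \<noteq> {}\<rbrakk> \<Longrightarrow> \<exists>e\<in>X. X - {e} \<in> F"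

definition inclusion_order :: "'e set set \<Rightarrow> 'e set gorder" where
  "inclusion_order F = \<lparr>carrier = F, eq = (=), le = (\<subseteq>)\<rparr>"

context antimatroid
begin

lemma feasible_subset: "X \<in> F \<Longrightarrow> X \<subseteq> E"
  using Union_feasible by blast

lemma feasible_finite: "X \<in> F \<Longrightarrow> finite X"
  using feasible_subset finite_ground finite_subset by blast

lemma finite_feasible: "finite F"
  using finite_ground feasible_subset finite_Pow_iff[of E] finite_subset[of F "Pow E"] by blast

lemma Union_closed: "A \<subseteq> F \<Longrightarrow> \<Union>A \<in> F"
proof -
  assume "A \<subseteq> F"
  then have "finite A" using finite_feasible finite_subset by blast
  then show ?thesis using \<open>A \<subseteq> F\<close>
    by induction (auto intro: empty_feasible union_feasible)
qed

text \<open>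
  Peel elements off \<open>X\<close> until what is left lies in \<open>Y\<close>: the element removed last is the new one.
\<close>

lemma augmentation:
  assumes "X \<in> F" "Y \<in> F" "\<not> X \<subseteq> Y"
  shows "\<exists>x\<in>X - Y. insert x Y \<in> F"
  using assms(1,3)
proof (induction "card X" arbitrary: X rule: less_induct)
  case less
  then have "X \<noteq> {}" by auto
  then obtain e where e: "e \<in> X" "X - {e} \<in> F" using accessible less.prems by blast
  show ?case
  proof (cases "X - {e} \<subseteq> Y")
    case True
    then have "X \<union> Y = insert e Y" using e less.prems by blast
    then show ?thesis using union_feasible[OF less.prems(1) assms(2)] e True less.prems by auto
  next
    case False
    have "card (X - {e}) < card X"
      using e feasible_finite less.prems by (intro card_Diff1_less) auto
    then show ?thesis using less.hyps[OF _ e(2) False] by blast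
  qed
qed

abbreviation "P \<equiv> inclusion_order F"

text \<open>
  The intersection of two feasible sets need not be feasible, so meets are computed by passing to
  the largest feasible subset.
\<close>

definition interior :: "'e set \<Rightarrow> 'e set" where
  "interior A = \<Union>{Z \<in> F. Z \<subseteq> A}"

lemma interior_feasible: "interior A \<in> F"
  unfolding interior_def by (rule Union_closed) auto

lemma interior_subset: "interior A \<subseteq> A"
  by (auto simp: interior_def)

lemma interior_greatest: "Z \<in> F \<Longrightarrow> Z \<subseteq> A \<Longrightarrow> Z \<subseteq> interior A"
  by (auto simp: interior_def)

lemma least_union:
  "X \<in> F \<Longrightarrow> Y \<in> F \<Longrightarrow> least P (X \<union> Y) (Upper P {X, Y})"
  by (auto simp: least_def Upper_def inclusion_order_def union_feasible)

lemma greatest_interior: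
  "X \<in> F \<Longrightarrow> Y \<in> F \<Longrightarrow> greatest P (interior (X \<inter> Y)) (Lower P {X, Y})"
  using interior_feasible[of "X \<inter> Y"] interior_subset[of "X \<inter> Y"] interior_greatest[of _ "X \<inter> Y"]
  by (auto simp: greatest_def Lower_def inclusion_order_def)

lemma lattice_feasible: "lattice P"
proof -
  interpret partial_order P
    by unfold_locales (auto simp: inclusion_order_def)
  show ?thesis
  proof unfold_locales
    fix x y assume "x \<in> carrier P" "y \<in> carrier P"
    then have xy: "x \<in> F" "y \<in> F" by (auto simp: inclusion_order_def)
    show "\<exists>s. least P s (Upper P {x, y})" using least_union[OF xy] ..
    show "\<exists>s. greatest P s (Lower P {x, y})" using greatest_interior[OF xy] ..
  qed
qed

sublocale feasible: lattice P
  by (rule lattice_feasible)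

lemma carrier_feasible: "carrier P = F"
  by (simp add: inclusion_order_def)

lemma join_feasible: "X \<in> F \<Longrightarrow> Y \<in> F \<Longrightarrow> X \<squnion>\<^bsub>P\<^esub> Y = X \<union> Y"
  using feasible.sup_of_two_least[of X Y] least_union[of X Y] feasible.least_unique
  by (metis carrier_feasible join_def)

lemma meet_feasible: "X \<in> F \<Longrightarrow> Y \<in> F \<Longrightarrow> X \<sqinter>\<^bsub>P\<^esub> Y = interior (X \<inter> Y)"
  using feasible.inf_of_two_greatest[of X Y] greatest_interior[of X Y] feasible.greatest_unique
  by (metis carrier_feasible meet_def)

lemma covered_by_feasible:
  "covered_by P X Y \<longleftrightarrow> X \<in> F \<and> Y \<in> F \<and> (\<exists>e. e \<notin> X \<and> Y = insert e X)"
proof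
  assume "covered_by P X Y"
  then have XY: "X \<in> F" "Y \<in> F" "X \<subset> Y" and btw: "\<not> (\<exists>Z\<in>F. X \<subset> Z \<and> Z \<subset> Y)"
    by (auto simp: covered_by_def lless_def inclusion_order_def psubset_eq)
  obtain e where e: "e \<in> Y - X" "insert e X \<in> F" using augmentation[of Y X] XY by auto
  then have "insert e X = Y" using btw XY by blast
  then show "X \<in> F \<and> Y \<in> F \<and> (\<exists>e. e \<notin> X \<and> Y = insert e X)" using XY e by auto
next
  assume "X \<in> F \<and> Y \<in> F \<and> (\<exists>e. e \<notin> X \<and> Y = insert e X)"
  then show "covered_by P X Y"
    by (auto simp: covered_by_def lless_def inclusion_order_def)
qed

lemma finite_lattice_feasible: "finite_lattice P"
  using lattice_feasible finite_feasible empty_feasible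
  by (auto simp: finite_lattice_def carrier_feasible)

text \<open>
  If \<open>A\<close> covers \<open>A \<sqinter> B\<close>, then \<open>A\<close> has exactly one element more than this meet, and that element is
  the only one that \<open>A\<close> contributes to \<open>A \<union> B\<close>.
\<close>

lemma semimodular_feasible: "semimodular P"
  unfolding semimodular_def carrier_feasible
proof (intro ballI impI)
  fix A B assume AB: "A \<in> F" "B \<in> F" and "covered_by P (A \<sqinter>\<^bsub>P\<^esub> B) A"
  then obtain e where e: "e \<notin> interior (A \<inter> B)" "A = insert e (interior (A \<inter> B))"
    by (auto simp: covered_by_feasible meet_feasible)
  have sub: "interior (A \<inter> B) \<subseteq> B" using interior_subset by blast
  have "e \<notin> B"
  proof
    assume "e \<in> B"
    then have "A \<subseteq> A \<inter> B" by (subst (1) e(2)) (use e(2) sub in auto)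
    then have "A \<subseteq> interior (A \<inter> B)" using interior_greatest AB by blast
    then show False using e by blast
  qed
  moreover have "A \<union> B = insert e B" using e(2) sub by blast
  ultimately show "covered_by P B (A \<squnion>\<^bsub>P\<^esub> B)"
    using AB union_feasible[OF AB] by (auto simp: covered_by_feasible join_feasible)
qed

text \<open>
  An element that enlarges the meet \<open>R\<close> inside \<open>A\<close> belongs to \<open>B\<close> or to \<open>C\<close>, so the enlarged set is
  a common lower bound of \<open>A\<close> and one of the others.
\<close>

lemma diamond_free_feasible:
  assumes A: "A \<in> F" and B: "B \<in> F" and C: "C \<in> F"
    and join: "A \<squnion>\<^bsub>P\<^esub> B = Q" "A \<squnion>\<^bsub>P\<^esub> C = Q" "B \<squnion>\<^bsub>P\<^esub> C = Q"
    and meet: "A \<sqinter>\<^bsub>P\<^esub> B = R" "A \<sqinter>\<^bsub>P\<^esub> C = R" "B \<sqinter>\<^bsub>P\<^esub> C = R"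
  shows "R = Q"
proof -
  have R: "R = interior (A \<inter> B)" "R = interior (A \<inter> C)" "R = interior (B \<inter> C)"
    using meet meet_feasible A B C by auto
  have Q: "A \<union> B = Q" "A \<union> C = Q" "B \<union> C = Q"
    using join join_feasible A B C by auto
  have RF: "R \<in> F" using R interior_feasible by simp
  have "A \<subseteq> R"
  proof (rule ccontr)
    assume "\<not> A \<subseteq> R"
    then obtain e where e: "e \<in> A - R" "insert e R \<in> F" using augmentation A RF by blast
    have "R \<subseteq> A" "R \<subseteq> B" "R \<subseteq> C" using R interior_subset by blast+
    moreover have "e \<in> B \<or> e \<in> C" using e Q by blast
    ultimately have "insert e R \<subseteq> A \<inter> B \<or> insert e R \<subseteq> A \<inter> C" using e by blast
    then have "insert e R \<subseteq> R" using interior_greatest[OF e(2)] R by metis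
    then show False using e by blast
  qed
  moreover have "R \<subseteq> B" "R \<subseteq> C" using R interior_subset by blast+
  ultimately have "B = Q" "C = Q" using Q by blast+
  then show ?thesis using R(3) interior_greatest[of Q Q] interior_subset[of Q] B by auto
qed

lemma diamond_free_semimodular_feasible: "diamond_free_semimodular P"
  unfolding diamond_free_semimodular_def feasible.diamond_sublattice_iff carrier_feasible
  using semimodular_feasible diamond_free_feasible by blast

end

section \<open>Complete sets of a DSC\<close>

lemma complete_Un:
  "complete_subset E dep X \<Longrightarrow> complete_subset E dep Y \<Longrightarrow> complete_subset E dep (X \<union> Y)"
  unfolding complete_subset_def by (meson Un_iff le_supI le_supI1 le_supI2)

context DSC
begin

lemma complete_E: "complete_subset E dep E"
  using nonsingular dep_subset by (fastforce simp: complete_subset_def)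

text \<open>
  A maximal proper complete subset \<open>Y\<close> of \<open>X\<close> misses only one element of \<open>X\<close>. To find an element
  that can be added to \<open>Y\<close>, take a minimal complete \<open>Z \<subseteq> X\<close> that is not contained in \<open>Y\<close>, and
  \<open>e \<in> Z - Y\<close>: a depset of \<open>e\<close> inside \<open>Z\<close> is complete and misses \<open>e\<close>, so it is smaller than \<open>Z\<close> and
  therefore contained in \<open>Y\<close>.
\<close>

lemma complete_accessible:
  assumes X: "complete_subset E dep X" and "X \<noteq> {}"
  shows "\<exists>e\<in>X. complete_subset E dep (X - {e})"
proof -
  have "finite X" using X finite_E finite_subset by (auto simp: complete_subset_def)
  define N where "N = {Y. Y \<subset> X \<and> complete_subset E dep Y}"
  have "finite N" "{} \<in> N"
    using \<open>finite X\<close> \<open>X \<noteq> {}\<close>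
    by (auto simp: N_def complete_subset_def intro: finite_subset[of _ "Pow X"])
  then obtain Y where "Y \<in> N" and "\<And>Z. Z \<in> N \<Longrightarrow> Y \<subseteq> Z \<Longrightarrow> Y = Z"
    using finite_has_maximal[of N] by blast
  then have Y: "Y \<subset> X" "complete_subset E dep Y"
    and max: "\<And>Z. Z \<subset> X \<Longrightarrow> complete_subset E dep Z \<Longrightarrow> Y \<subseteq> Z \<Longrightarrow> Y = Z"
    by (auto simp: N_def)
  define M where "M = {Z. Z \<subseteq> X \<and> complete_subset E dep Z \<and> \<not> Z \<subseteq> Y}"
  have "finite M" "X \<in> M"
    using \<open>finite X\<close> X Y by (auto simp: M_def intro: finite_subset[of _ "Pow X"])
  then obtain Z where Z: "Z \<in> M" and min: "\<And>W. W \<in> M \<Longrightarrow> W \<subseteq> Z \<Longrightarrow> Z = W"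
    using finite_has_minimal[of M] by blast
  then obtain e where e: "e \<in> Z" "e \<notin> Y" by (auto simp: M_def)
  then obtain D where D: "D \<in> dep e" "D \<subseteq> Z"
    using Z by (fastforce simp: M_def complete_subset_def)
  have eE: "e \<in> E" "e \<in> X" using Z e by (auto simp: M_def complete_subset_def)
  have "D \<noteq> Z" using acyclic[OF eE(1) D(1)] e by auto
  then have "D \<notin> M" using min D by blast
  then have "D \<subseteq> Y" using D Z complete_depsets[OF eE(1) D(1)] by (auto simp: M_def)
  then have "complete_subset E dep (insert e Y)"
    using Y(2) D(1) eE(1) subset_insertI2[of _ Y e] unfolding complete_subset_def by blast
  then have "insert e Y = X" using max[of "insert e Y"] Y eE e by blast
  then show ?thesis using Y e eE by (intro bexI[of _ e]) auto
qed

lemma reachable_step: "reachable E dep X \<Longrightarrow> rch E dep X Y \<Longrightarrow> reachable E dep Y"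
proof -
  assume "reachable E dep X" and XY: "rch E dep X Y"
  then obtain n Xs where s: "rch E dep {} (Xs 0)" "\<And>i. i < n \<Longrightarrow> rch E dep (Xs i) (Xs (Suc i))"
    "rch E dep (Xs n) X" by (auto simp: reachable_def)
  show ?thesis unfolding reachable_def
    using s XY by (intro exI[of _ "Suc n"] exI[of _ "\<lambda>i. if i \<le> n then Xs i else X"])
      (auto simp: less_Suc_eq)
qed

text \<open>
  A complete set is built up from \<open>{}\<close> one element at a time: the element \<open>e\<close> removed by
  \<open>complete_accessible\<close> has a depset in \<open>X\<close>, which avoids \<open>e\<close> by acyclicity, so \<open>X\<close> is reached from
  \<open>X - {e}\<close> in one step.
\<close>

lemma reachable_iff_complete: "reachable E dep X \<longleftrightarrow> complete_subset E dep X"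
proof
  assume "reachable E dep X"
  then show "complete_subset E dep X"
    unfolding reachable_def rch_def complete_subset_def by (meson subset_trans)
next
  assume "complete_subset E dep X"
  then show "reachable E dep X"
  proof (induction "card X" arbitrary: X rule: less_induct)
    case less
    show ?case
    proof (cases "X = {}")
      case True
      then show ?thesis
        unfolding reachable_def rch_def by (intro exI[of _ 0] exI[of _ "\<lambda>_. {}"]) auto
    next
      case False
      then obtain e where e: "e \<in> X" "complete_subset E dep (X - {e})"
        using complete_accessible less.prems by blast
      have "finite X" "X \<subseteq> E"
        using less.prems finite_E finite_subset by (auto simp: complete_subset_def)
      then have "reachable E dep (X - {e})"
        using less.hyps[OF card_Diff1_less e(2)] e(1) by blast
      moreover obtain D where "D \<in> dep e" "D \<subseteq> X - {e}"
        using less.prems e(1) acyclic \<open>X \<subseteq> E\<close> by (fastforce simp: complete_subset_def)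
      then have "rch E dep (X - {e}) X"
        using e \<open>X \<subseteq> E\<close> unfolding rch_def complete_subset_def
        by (metis Diff_subset insertE insert_Diff)
      ultimately show ?thesis by (rule reachable_step)
    qed
  qed
qed

lemma antimatroid_complete: "antimatroid E (Collect (complete_subset E dep))"
proof
  show "\<Union> (Collect (complete_subset E dep)) = E"
    using complete_E by (auto simp: complete_subset_def)
qed (use finite_E complete_Un complete_accessible in \<open>auto simp: complete_subset_def[of _ _ "{}"]\<close>)

lemma rdp_eq: "rdp E dep = inclusion_order (Collect (complete_subset E dep))"
  by (simp add: rdp_def inclusion_order_def reachable_iff_complete)

end

section \<open>Every antimatroid comes from a DSC\<close>

context antimatroid
begin

definition entries :: "'e \<Rightarrow> 'e set set" where
  "entries e = {D \<in> F. e \<notin> D \<and> insert e D \<in> F}"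

text \<open>
  Passing to the minimal entries makes the dependency function irredundant without changing which
  sets are complete.
\<close>

definition depsets :: "'e \<Rightarrow> 'e set set" where
  "depsets e = {D \<in> entries e. \<forall>D'\<in>entries e. D' \<subseteq> D \<longrightarrow> D' = D}"

text \<open>
  While elements are removed from \<open>X\<close> one by one through feasible sets, \<open>e\<close> has to leave at some
  point; the set that remains at that moment is an entry of \<open>e\<close>.
\<close>

lemma ex_entry: "X \<in> F \<Longrightarrow> e \<in> X \<Longrightarrow> \<exists>D\<in>entries e. D \<subseteq> X"
proof (induction "card X" arbitrary: X rule: less_induct)
  case less
  then obtain x where x: "x \<in> X" "X - {x} \<in> F" using accessible by blast
  show ?case
  proof (cases "x = e")
    case True
    then show ?thesis
      using x less.prems by (intro bexI[of _ "X - {e}"]) (auto simp: entries_def insert_absorb)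
  next
    case False
    have "card (X - {x}) < card X"
      using x feasible_finite less.prems by (intro card_Diff1_less) auto
    then show ?thesis using less.hyps[OF _ x(2)] less.prems False by blast
  qed
qed

lemma ex_depset:
  assumes "X \<in> F" "e \<in> X"
  shows "\<exists>D\<in>depsets e. D \<subseteq> X"
proof -
  obtain D0 where D0: "D0 \<in> entries e" "D0 \<subseteq> X" using ex_entry assms by blast
  have "finite (entries e)" using finite_feasible by (auto simp: entries_def)
  then obtain D where "D \<in> entries e" "D \<subseteq> D0" "\<forall>D'\<in>entries e. D' \<subseteq> D \<longrightarrow> D = D'"
    using finite_has_minimal2[OF _ D0(1)] by blast
  then show ?thesis using D0 by (intro bexI[of _ D]) (auto simp: depsets_def)
qed

text \<open>
  A complete \<open>X\<close> is the union of the feasible sets \<open>insert e D\<close>, where \<open>D \<subseteq> X\<close> is a depset of \<open>e \<in> X\<close>.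
\<close>

lemma complete_depsets_iff: "complete_subset E depsets X \<longleftrightarrow> X \<in> F"
proof
  assume X: "complete_subset E depsets X"
  then obtain D where D: "\<And>e. e \<in> X \<Longrightarrow> D e \<in> depsets e \<and> D e \<subseteq> X"
    unfolding complete_subset_def by metis
  have "X = (\<Union>e\<in>X. insert e (D e))" using D by blast
  moreover have "(\<Union>e\<in>X. insert e (D e)) \<in> F"
    by (rule Union_closed) (use D in \<open>auto simp: depsets_def entries_def\<close>)
  ultimately show "X \<in> F" by simp
next
  assume "X \<in> F"
  then show "complete_subset E depsets X"
    using ex_depset feasible_subset by (auto simp: complete_subset_def)
qed

lemma DSC_depsets: "DSC E depsets"
proof
  show "depsets e \<noteq> {}" if "e \<in> E" for e
    using that Union_feasible ex_depset by blast
  show "complete_subset E depsets D" if "D \<in> depsets e" for e D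
    using that by (auto simp: complete_depsets_iff depsets_def entries_def)
  show "depsets e \<subseteq> Pow E" for e
    using feasible_subset by (auto simp: depsets_def entries_def)
qed (use finite_ground in \<open>auto simp: depsets_def entries_def\<close>)

lemma rdp_depsets: "rdp E depsets = inclusion_order F"
  using DSC.rdp_eq[OF DSC_depsets] by (simp add: complete_depsets_iff[abs_def])

text \<open>
  A finite ground set can be relabelled, in particular by natural numbers.
\<close>

lemma antimatroid_image:
  assumes g: "inj_on g E"
  shows "antimatroid (g ` E) ((`) g ` F)"
proof
  show "finite (g ` E)" using finite_ground by simp
  show "\<Union> ((`) g ` F) = g ` E" using Union_feasible by auto
  show "{} \<in> (`) g ` F" using empty_feasible by auto
  show "X \<union> Y \<in> (`) g ` F" if "X \<in> (`) g ` F" "Y \<in> (`) g ` F" for X Y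
    using that union_feasible by (auto simp flip: image_Un)
  show "\<exists>e\<in>X. X - {e} \<in> (`) g ` F" if "X \<in> (`) g ` F" "X \<noteq> {}" for X
  proof -
    obtain Z where Z: "Z \<in> F" "X = g ` Z" using \<open>X \<in> _\<close> by blast
    then have "Z \<noteq> {}" using \<open>X \<noteq> {}\<close> by auto
    then obtain e where e: "e \<in> Z" "Z - {e} \<in> F" using accessible[OF Z(1)] by auto
    have "g ` (Z - {e}) = X - {g e}"
      using inj_on_image_set_diff[OF g, of Z "{e}"] Z e feasible_subset[OF Z(1)] by auto
    then have "X - {g e} \<in> (`) g ` F" using imageI[OF e(2), of "(`) g"] by simp
    then show ?thesis using e(1) Z(2) by auto
  qed
qed

end

section \<open>Covers in finite posets\<close>

locale finite_poset = partial_order L for L (structure) +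
  assumes finite_carrier: "finite (carrier L)"
begin

lemma lless_iff: "x \<sqsubset> y \<longleftrightarrow> x \<sqsubseteq> y \<and> x \<noteq> y"
  by (simp add: lless_def eq_is_equal)

lemma strict_order_on:
  assumes "A \<subseteq> carrier L"
  shows "asymp_on A (\<sqsubset>)" "transp_on A (\<sqsubset>)"
proof -
  show "asymp_on A (\<sqsubset>)"
    by (rule asymp_onI) (meson assms in_mono lless_antisym)
  show "transp_on A (\<sqsubset>)"
    by (rule transp_onI) (meson assms in_mono lless_trans)
qed

lemma ex_minimal:
  assumes "A \<subseteq> carrier L" "A \<noteq> {}"
  shows "\<exists>m\<in>A. \<forall>x\<in>A. x \<sqsubseteq> m \<longrightarrow> x = m"
proof -
  have "finite A" using assms finite_carrier finite_subset by blast
  then show ?thesis using Finite_Set.bex_min_element[of A "(\<sqsubset>)"] assms strict_order_on[of A]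
    by (auto simp: lless_iff)
qed

lemma ex_maximal:
  assumes "A \<subseteq> carrier L" "A \<noteq> {}"
  shows "\<exists>m\<in>A. \<forall>x\<in>A. m \<sqsubseteq> x \<longrightarrow> x = m"
proof -
  have "finite A" using assms finite_carrier finite_subset by blast
  then show ?thesis using Finite_Set.bex_max_element[of A "(\<sqsubset>)"] assms strict_order_on[of A]
    by (auto simp: lless_iff)
qed

lemma downward_induct [consumes 1, case_names step]:
  assumes "y \<in> carrier L"
    and step: "\<And>y. y \<in> carrier L \<Longrightarrow> (\<And>z. z \<in> carrier L \<Longrightarrow> y \<sqsubset> z \<Longrightarrow> Q z) \<Longrightarrow> Q y"
  shows "Q y"
proof (rule ccontr)
  assume "\<not> Q y"
  then obtain m where "m \<in> carrier L" "\<not> Q m"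
    and "\<forall>z\<in>carrier L. \<not> Q z \<longrightarrow> m \<sqsubseteq> z \<longrightarrow> z = m"
    using ex_maximal[of "{z \<in> carrier L. \<not> Q z}"] assms(1) by blast
  then show False using step[of m] by (auto simp: lless_iff)
qed

lemma covered_by_iff:
  "covered_by L x y \<longleftrightarrow> x \<in> carrier L \<and> y \<in> carrier L \<and> x \<sqsubseteq> y \<and> x \<noteq> y \<and>
     (\<forall>z\<in>carrier L. x \<sqsubseteq> z \<longrightarrow> z \<sqsubseteq> y \<longrightarrow> z = x \<or> z = y)"
  by (auto simp: covered_by_def lless_iff)

lemma covered_byD:
  assumes "covered_by L x y"
  shows "x \<in> carrier L" "y \<in> carrier L" "x \<sqsubseteq> y" "x \<noteq> y"
    "\<And>z. z \<in> carrier L \<Longrightarrow> x \<sqsubseteq> z \<Longrightarrow> z \<sqsubseteq> y \<Longrightarrow> z = x \<or> z = y"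
  using assms by (auto simp: covered_by_iff)

lemma ex_upper_cover:
  assumes "y \<in> carrier L" "z \<in> carrier L" "y \<sqsubseteq> z" "y \<noteq> z"
  shows "\<exists>a. covered_by L y a \<and> a \<sqsubseteq> z"
proof -
  obtain a where a: "a \<in> carrier L" "y \<sqsubseteq> a" "y \<noteq> a" "a \<sqsubseteq> z"
    and min: "\<And>w. w \<in> carrier L \<Longrightarrow> y \<sqsubseteq> w \<Longrightarrow> y \<noteq> w \<Longrightarrow> w \<sqsubseteq> z \<Longrightarrow> w \<sqsubseteq> a \<Longrightarrow> w = a"
    using ex_minimal[of "{a \<in> carrier L. y \<sqsubseteq> a \<and> y \<noteq> a \<and> a \<sqsubseteq> z}"] assms by auto
  then have "covered_by L y a"
    unfolding covered_by_iff using assms le_trans[of _ a z] by metis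
  with a show ?thesis by blast
qed

lemma ex_lower_cover:
  assumes "y \<in> carrier L" "z \<in> carrier L" "y \<sqsubseteq> z" "y \<noteq> z"
  shows "\<exists>a. covered_by L a z"
proof -
  obtain a where a: "a \<in> carrier L" "a \<sqsubseteq> z" "a \<noteq> z"
    and max: "\<And>w. w \<in> carrier L \<Longrightarrow> w \<sqsubseteq> z \<Longrightarrow> w \<noteq> z \<Longrightarrow> a \<sqsubseteq> w \<Longrightarrow> w = a"
    using ex_maximal[of "{a \<in> carrier L. a \<sqsubseteq> z \<and> a \<noteq> z}"] assms by auto
  then have "covered_by L a z"
    unfolding covered_by_iff using assms by metis
  then show ?thesis by blast
qed

end

section \<open>Diamond-free semimodular lattices are lattices of feasible sets\<close>

lemma (in upper_semilattice) join_mono: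
  assumes "x \<in> carrier L" "x' \<in> carrier L" "y \<in> carrier L" "y' \<in> carrier L"
    and "x \<sqsubseteq> x'" "y \<sqsubseteq> y'"
  shows "x \<squnion> y \<sqsubseteq> x' \<squnion> y'"
proof (rule join_le)
  show "x \<sqsubseteq> x' \<squnion> y'" by (rule le_trans[OF assms(5)]) (use assms join_left in auto)
  show "y \<sqsubseteq> x' \<squnion> y'" by (rule le_trans[OF assms(6)]) (use assms join_right in auto)
qed (use assms in auto)

locale diamond_free_semimodular_lattice = lattice L + finite_poset L for L (structure) +
  assumes carrier_nonempty: "carrier L \<noteq> {}"
    and diamond_free_semimodular: "diamond_free_semimodular L"
begin

lemma meet_eq_of_cover:
  assumes c: "covered_by L y x" and z: "z \<in> carrier L" "y \<sqsubseteq> z" "\<not> x \<sqsubseteq> z"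
  shows "x \<sqinter> z = y"
proof -
  note x = covered_byD[OF c]
  have "y \<sqsubseteq> x \<sqinter> z" using meet_le x z by blast
  moreover have "x \<sqinter> z \<sqsubseteq> x" "x \<sqinter> z \<sqsubseteq> z" using meet_left meet_right x z by blast+
  ultimately show ?thesis using x(5)[of "x \<sqinter> z"] x(2) z by (metis meet_closed)
qed

lemma cover_join:
  assumes c: "covered_by L y x" and z: "z \<in> carrier L" "y \<sqsubseteq> z" "\<not> x \<sqsubseteq> z"
  shows "covered_by L z (x \<squnion> z)"
  using diamond_free_semimodular meet_eq_of_cover[OF assms] c z covered_byD(2)[OF c]
  by (auto simp: diamond_free_semimodular_def semimodular_def)

text \<open>
  By semimodularity \<open>a \<squnion> b\<close> covers both \<open>a\<close> and \<open>b\<close>. If \<open>x\<close> were below it, the joins of \<open>x\<close> with \<open>a\<close>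
  and with \<open>b\<close> would equal \<open>a \<squnion> b\<close> too, and \<open>x\<close>, \<open>a\<close>, \<open>b\<close> would form a diamond over \<open>y\<close>.
\<close>

lemma join_of_covers_avoids:
  assumes "covered_by L y x" "covered_by L y a" "covered_by L y b" "a \<noteq> b" "a \<noteq> x" "b \<noteq> x"
  shows "\<not> x \<sqsubseteq> a \<squnion> b"
proof
  assume x: "x \<sqsubseteq> a \<squnion> b"
  note cs = assms(1-3)[THEN covered_byD(1)] assms(1-3)[THEN covered_byD(2)]
    assms(1-3)[THEN covered_byD(3)]
  have nle: "\<not> u \<sqsubseteq> v" if "covered_by L y u" "covered_by L y v" "u \<noteq> v" for u v
    using covered_byD[OF that(1)] covered_byD[OF that(2)] that(3) by metis
  have meet: "u \<sqinter> v = y" if "covered_by L y u" "covered_by L y v" "u \<noteq> v" for u v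
    using meet_eq_of_cover[OF that(1) _ _ nle[OF that]] covered_byD[OF that(2)] by blast
  have join: "x \<squnion> v = a \<squnion> b" if v: "v \<in> {a, b}" for v
  proof -
    obtain u where u: "covered_by L y u" "covered_by L y v" "u \<noteq> v" "u \<squnion> v = a \<squnion> b"
    proof (cases "v = a")
      case True
      then show ?thesis using that[of b] assms join_comm[of L] by metis
    next
      case False
      then show ?thesis using that[of a] assms v by auto
    qed
    then have c: "covered_by L v (a \<squnion> b)"
      using cover_join[OF u(1), of v] nle covered_byD[OF u(2)] by metis
    note vd = covered_byD[OF c]
    have xv: "\<not> x \<sqsubseteq> v" using nle[OF assms(1) u(2)] v assms by auto
    have "v \<sqsubseteq> x \<squnion> v" "x \<sqsubseteq> x \<squnion> v" using join_left join_right cs vd by blast+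
    moreover have "x \<squnion> v \<sqsubseteq> a \<squnion> b" using join_le x vd cs by blast
    ultimately show ?thesis using vd(5)[of "x \<squnion> v"] xv cs vd(1) by auto
  qed
  have "\<not> (\<exists>a\<in>carrier L. \<exists>b\<in>carrier L. \<exists>c\<in>carrier L. \<exists>p q. p \<noteq> q \<and>
      a \<sqinter> b = p \<and> a \<sqinter> c = p \<and> b \<sqinter> c = p \<and> a \<squnion> b = q \<and> a \<squnion> c = q \<and> b \<squnion> c = q)"
    using diamond_free_semimodular
    unfolding diamond_free_semimodular_def diamond_sublattice_iff by blast
  moreover have "y \<noteq> a \<squnion> b"
    using join_left[of a b] cs assms(2) covered_byD[OF assms(2)] by (metis le_antisym)
  ultimately show False
    using join[of a] join[of b] meet[OF assms(1,2)] meet[OF assms(1,3)] meet[OF assms(2,3)]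
      assms(4-6) cs(4-6) by blast
qed

text \<open>
  The induction descends from the top: a failure at \<open>y\<close> is moved to some \<open>w\<close> strictly above \<open>y\<close>, where
  \<open>x\<close> is replaced by the cover \<open>x \<squnion> w\<close> of \<open>w\<close>. With distinct covers \<open>a\<close> and \<open>b\<close> of \<open>y\<close> below \<open>z\<^sub>1\<close> and \<open>z\<^sub>2\<close>, three
  facts combine. Diamond-freeness shows that \<open>a \<squnion> b\<close> avoids \<open>x\<close>; the hypothesis at \<open>b\<close>, applied to
  \<open>a \<squnion> b\<close> and \<open>z\<^sub>2\<close>, shows that \<open>a \<squnion> z\<^sub>2\<close> does; and the hypothesis at \<open>a\<close>, applied to \<open>z\<^sub>1\<close> and \<open>a \<squnion> z\<^sub>2\<close>,
  shows that \<open>z\<^sub>1 \<squnion> z\<^sub>2\<close> does.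
\<close>

lemma join_avoids:
  assumes "y \<in> carrier L" "covered_by L y x" "z\<^sub>1 \<in> carrier L" "z\<^sub>2 \<in> carrier L"
    "y \<sqsubseteq> z\<^sub>1" "y \<sqsubseteq> z\<^sub>2" "\<not> x \<sqsubseteq> z\<^sub>1" "\<not> x \<sqsubseteq> z\<^sub>2"
  shows "\<not> x \<sqsubseteq> z\<^sub>1 \<squnion> z\<^sub>2"
  using assms
proof (induction y arbitrary: x z\<^sub>1 z\<^sub>2 rule: downward_induct)
  case (step y)
  note x = covered_byD[OF \<open>covered_by L y x\<close>]
  have IH: "\<not> x \<sqsubseteq> u \<squnion> v"
    if w: "w \<in> carrier L" "y \<sqsubset> w" and uv: "u \<in> carrier L" "v \<in> carrier L" "w \<sqsubseteq> u" "w \<sqsubseteq> v"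
      and n: "\<not> x \<sqsubseteq> u" "\<not> x \<sqsubseteq> v" for w u v
  proof -
    have "\<not> x \<sqsubseteq> w" using w uv n x(2) le_trans by blast
    then have "covered_by L w (x \<squnion> w)"
      using cover_join step.prems w by (simp add: lless_iff)
    moreover have xw: "x \<sqsubseteq> x \<squnion> w" "x \<squnion> w \<in> carrier L"
      using join_left x w by auto
    moreover have "\<not> x \<squnion> w \<sqsubseteq> u" "\<not> x \<squnion> w \<sqsubseteq> v"
      using n xw uv x(2) le_trans by blast+
    ultimately have "\<not> x \<squnion> w \<sqsubseteq> u \<squnion> v"
      using step.IH w uv by blast
    moreover have "w \<sqsubseteq> u \<squnion> v" using uv w le_trans[of w u "u \<squnion> v"] join_left by auto
    ultimately show ?thesis using join_le[of x "u \<squnion> v" w] x(2) w uv by auto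
  qed
  show ?case
  proof (cases "y = z\<^sub>1 \<or> y = z\<^sub>2")
    case True
    then have "z\<^sub>1 \<squnion> z\<^sub>2 \<in> {z\<^sub>1, z\<^sub>2}"
      using step.prems le_iff_meet[of z\<^sub>1 z\<^sub>2] le_iff_meet[of z\<^sub>2 z\<^sub>1] join_comm[of L z\<^sub>1 z\<^sub>2] by auto
    then show ?thesis using step.prems by auto
  next
    case False
    obtain a where a: "covered_by L y a" "a \<sqsubseteq> z\<^sub>1"
      using ex_upper_cover[of y z\<^sub>1] step.hyps step.prems False by blast
    obtain b where b: "covered_by L y b" "b \<sqsubseteq> z\<^sub>2"
      using ex_upper_cover[of y z\<^sub>2] step.hyps step.prems False by blast
    note ad = covered_byD[OF a(1)] and bd = covered_byD[OF b(1)]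
    have ya: "y \<sqsubset> a" and yb: "y \<sqsubset> b" using ad bd by (auto simp: lless_iff)
    have na: "\<not> x \<sqsubseteq> a" and nb: "\<not> x \<sqsubseteq> b"
      using a b step.prems x(2) ad bd le_trans by blast+
    show ?thesis
    proof (cases "a = b")
      case True
      then show ?thesis using IH[of a z\<^sub>1 z\<^sub>2] a b ad ya step.prems by blast
    next
      case False
      note cl = ad(2) bd(2) step.prems(2,3)
      have "\<not> x \<sqsubseteq> a \<squnion> b"
        using join_of_covers_avoids[OF step.prems(1) a(1) b(1) False] na nb x(2) by blast
      then have "\<not> x \<sqsubseteq> (a \<squnion> b) \<squnion> z\<^sub>2"
        using IH[of b "a \<squnion> b" z\<^sub>2] yb b step.prems cl join_right by auto
      moreover have "a \<squnion> z\<^sub>2 \<sqsubseteq> (a \<squnion> b) \<squnion> z\<^sub>2"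
        by (rule join_mono) (use cl join_left in auto)
      ultimately have "\<not> x \<sqsubseteq> a \<squnion> z\<^sub>2"
        using le_trans[of x "a \<squnion> z\<^sub>2" "(a \<squnion> b) \<squnion> z\<^sub>2"] cl x(2) by auto
      then have "\<not> x \<sqsubseteq> z\<^sub>1 \<squnion> (a \<squnion> z\<^sub>2)"
        using IH[of a z\<^sub>1 "a \<squnion> z\<^sub>2"] ya a step.prems cl join_left by auto
      moreover have "z\<^sub>1 \<squnion> z\<^sub>2 \<sqsubseteq> z\<^sub>1 \<squnion> (a \<squnion> z\<^sub>2)"
        by (rule join_mono) (use cl join_right in auto)
      ultimately show ?thesis
        using le_trans[of x "z\<^sub>1 \<squnion> z\<^sub>2" "z\<^sub>1 \<squnion> (a \<squnion> z\<^sub>2)"] cl x(2) by auto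
    qed
  qed
qed

text \<open>
  In a finite lattice, meet-irreducible means that there is a least element \<open>u\<close> strictly above \<open>m\<close>, its
  unique upper cover. The top element is excluded because nothing lies strictly above it.
\<close>

definition meet_irreducibles :: "'a set" where
  "meet_irreducibles = {m \<in> carrier L. \<exists>u\<in>carrier L. m \<sqsubset> u \<and> (\<forall>z\<in>carrier L. m \<sqsubset> z \<longrightarrow> u \<sqsubseteq> z)}"

text \<open>
  An element that is maximal among those above \<open>y\<close> and not above \<open>x\<close> is meet-irreducible, since
  everything strictly above it is also above \<open>x\<close>.
\<close>

lemma meet_irreducible_separates:
  assumes xy: "x \<in> carrier L" "y \<in> carrier L" "\<not> x \<sqsubseteq> y"
  shows "\<exists>m\<in>meet_irreducibles. y \<sqsubseteq> m \<and> \<not> x \<sqsubseteq> m"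
proof -
  define A where "A = {m \<in> carrier L. y \<sqsubseteq> m \<and> \<not> x \<sqsubseteq> m}"
  have "A \<subseteq> carrier L" "y \<in> A" using xy by (auto simp: A_def)
  then obtain m where "m \<in> A" and "\<forall>z\<in>A. m \<sqsubseteq> z \<longrightarrow> z = m"
    using ex_maximal[of A] by blast
  then have m: "m \<in> carrier L" "y \<sqsubseteq> m" "\<not> x \<sqsubseteq> m"
    and max: "\<And>z. z \<in> carrier L \<Longrightarrow> y \<sqsubseteq> z \<Longrightarrow> \<not> x \<sqsubseteq> z \<Longrightarrow> m \<sqsubseteq> z \<Longrightarrow> z = m"
    by (simp_all add: A_def)
  have "x \<squnion> m \<sqsubseteq> z" if "z \<in> carrier L" "m \<sqsubset> z" for z
  proof -
    have "x \<sqsubseteq> z" using max[of z] that m xy le_trans[of y m z] by (auto simp: lless_iff)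
    then show ?thesis using join_le that m xy by (auto simp: lless_iff)
  qed
  moreover have "m \<sqsubset> x \<squnion> m"
    using join_left[of x m] join_right[of x m] m xy by (auto simp: lless_iff)
  ultimately have "m \<in> meet_irreducibles"
    unfolding meet_irreducibles_def using m xy by auto
  with m show ?thesis by blast
qed

text \<open>
  The upper cover \<open>u\<close> of \<open>m\<close> is \<open>x \<squnion> m\<close> by semimodularity. If \<open>n\<close> were not below \<open>m\<close>, then \<open>m \<squnion> n\<close> would lie
  above \<open>u\<close> and hence above \<open>x\<close>, against \<open>join_avoids\<close>. So two meet-irreducibles that both separate
  \<open>y\<close> from \<open>x\<close> are below each other.
\<close>

lemma meet_irreducible_above_avoiders:
  assumes c: "covered_by L y x" and m: "m \<in> meet_irreducibles" "y \<sqsubseteq> m" "\<not> x \<sqsubseteq> m"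
    and n: "n \<in> carrier L" "y \<sqsubseteq> n" "\<not> x \<sqsubseteq> n"
  shows "n \<sqsubseteq> m"
proof (rule ccontr)
  assume "\<not> n \<sqsubseteq> m"
  obtain u where mc: "m \<in> carrier L" and u: "u \<in> carrier L" "m \<sqsubset> u"
    and least: "\<And>z. z \<in> carrier L \<Longrightarrow> m \<sqsubset> z \<Longrightarrow> u \<sqsubseteq> z"
    using m by (auto simp: meet_irreducibles_def)
  note x = covered_byD[OF c]
  have "m \<sqsubset> m \<squnion> n"
    using join_left[of m n] join_right[of m n] mc n \<open>\<not> n \<sqsubseteq> m\<close> by (auto simp: lless_iff)
  then have "u \<sqsubseteq> m \<squnion> n" using least mc n by auto
  have "covered_by L m (x \<squnion> m)" using cover_join c mc m by blast
  note d = covered_byD[OF this]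
  have "u \<sqsubseteq> x \<squnion> m" using least d by (auto simp: lless_iff)
  then have "u = x \<squnion> m" using d(5) u by (auto simp: lless_iff)
  then have "x \<sqsubseteq> u" using join_left x mc by auto
  then have "x \<sqsubseteq> m \<squnion> n" using \<open>u \<sqsubseteq> m \<squnion> n\<close> le_trans x(2) u(1) mc n by (meson join_closed)
  then show False using join_avoids[OF x(1) c mc n(1)] m n by blast
qed

definition nonupper :: "'a \<Rightarrow> 'a set" where
  "nonupper x = {m \<in> meet_irreducibles. \<not> x \<sqsubseteq> m}"

lemma nonupper_subset_iff: "x \<in> carrier L \<Longrightarrow> y \<in> carrier L \<Longrightarrow> nonupper x \<subseteq> nonupper y \<longleftrightarrow> x \<sqsubseteq> y"
proof
  assume xy: "x \<in> carrier L" "y \<in> carrier L"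
  show "x \<sqsubseteq> y" if "nonupper x \<subseteq> nonupper y"
    using meet_irreducible_separates[OF xy] that unfolding nonupper_def by blast
  show "nonupper x \<subseteq> nonupper y" if "x \<sqsubseteq> y"
    using that xy le_trans[of x y] by (auto simp: nonupper_def meet_irreducibles_def)
qed

lemma nonupper_cover:
  assumes c: "covered_by L y x"
  shows "\<exists>m. m \<in> nonupper x \<and> nonupper y = nonupper x - {m}"
proof -
  note x = covered_byD[OF c]
  have "\<not> x \<sqsubseteq> y" using x by auto
  then obtain m where m: "m \<in> meet_irreducibles" "y \<sqsubseteq> m" "\<not> x \<sqsubseteq> m"
    using meet_irreducible_separates x by blast
  have "n = m" if n: "n \<in> meet_irreducibles" "y \<sqsubseteq> n" "\<not> x \<sqsubseteq> n" for n
    using meet_irreducible_above_avoiders[OF c m] meet_irreducible_above_avoiders[OF c n] m n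
    by (auto simp: meet_irreducibles_def)
  then have "nonupper x - nonupper y = {m}" using m unfolding nonupper_def by blast
  moreover have "nonupper y \<subseteq> nonupper x" using nonupper_subset_iff x(1-3) by simp
  ultimately show ?thesis by blast
qed

text \<open>
  Union-closure comes from \<open>x \<squnion> y \<sqsubseteq> m \<longleftrightarrow> x \<sqsubseteq> m \<and> y \<sqsubseteq> m\<close>, accessibility from stepping down to a lower
  cover.
\<close>

lemma antimatroid_nonupper: "antimatroid meet_irreducibles (nonupper ` carrier L)"
proof
  show "finite meet_irreducibles" using finite_carrier by (auto simp: meet_irreducibles_def)
  obtain bot where bot: "bot \<in> carrier L" "\<And>x. x \<in> carrier L \<Longrightarrow> bot \<sqsubseteq> x"
  proof -
    obtain l where "l \<in> carrier L" and min: "\<forall>x\<in>carrier L. x \<sqsubseteq> l \<longrightarrow> x = l"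
      using ex_minimal carrier_nonempty by blast
    moreover have "l \<sqsubseteq> x" if "x \<in> carrier L" for x
      using min meet_left[of l x] meet_right[of l x] that \<open>l \<in> carrier L\<close> by force
    ultimately show ?thesis using that by blast
  qed
  then have bot_empty: "nonupper bot = {}" by (auto simp: nonupper_def meet_irreducibles_def)
  then show "{} \<in> nonupper ` carrier L" using bot by blast
  show "\<Union> (nonupper ` carrier L) = meet_irreducibles"
  proof
    show "meet_irreducibles \<subseteq> \<Union> (nonupper ` carrier L)"
    proof
      fix m assume m: "m \<in> meet_irreducibles"
      then obtain u where "m \<in> carrier L" "u \<in> carrier L" "m \<sqsubset> u"
        by (auto simp: meet_irreducibles_def)
      then have "\<not> u \<sqsubseteq> m" by (auto simp: lless_iff)
      then show "m \<in> \<Union> (nonupper ` carrier L)" using m \<open>u \<in> carrier L\<close> by (auto simp: nonupper_def)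
    qed
  qed (auto simp: nonupper_def)
  show "X \<union> Y \<in> nonupper ` carrier L" if XY: "X \<in> nonupper ` carrier L" "Y \<in> nonupper ` carrier L" for X Y
  proof -
    obtain x y where xy: "x \<in> carrier L" "y \<in> carrier L" "X = nonupper x" "Y = nonupper y" using XY by blast
    have "x \<squnion> y \<sqsubseteq> m \<longleftrightarrow> x \<sqsubseteq> m \<and> y \<sqsubseteq> m" if "m \<in> carrier L" for m
      using xy that join_le[of x m y] join_left[of x y] join_right[of x y]
        le_trans[of x "x \<squnion> y" m] le_trans[of y "x \<squnion> y" m] by auto
    then have "nonupper (x \<squnion> y) = X \<union> Y" using xy by (auto simp: nonupper_def meet_irreducibles_def)
    then show ?thesis using xy by (metis imageI join_closed)
  qed
  show "\<exists>e\<in>X. X - {e} \<in> nonupper ` carrier L" if X: "X \<in> nonupper ` carrier L" "X \<noteq> {}" for X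
  proof -
    obtain x where x: "x \<in> carrier L" "X = nonupper x" using X by blast
    then have "bot \<noteq> x" using bot_empty X by auto
    then obtain y where c: "covered_by L y x" using ex_lower_cover[of bot x] bot x by blast
    then obtain m where "m \<in> nonupper x" "nonupper y = nonupper x - {m}" using nonupper_cover by blast
    then show ?thesis using covered_byD(1)[OF c] x(2) by (metis imageI)
  qed
qed

end

section \<open>The correspondence\<close>

lemma (in diamond_free_semimodular_lattice) represented_by_DSC:
  "\<exists>(E :: nat set) dep. DSC E dep \<and> order_isomorphic L (rdp E dep)"
proof -
  interpret A: antimatroid meet_irreducibles "nonupper ` carrier L" by (rule antimatroid_nonupper)
  obtain g :: "'a \<Rightarrow> nat" where g: "inj_on g meet_irreducibles"
    using finite_imp_inj_to_nat_seg[OF A.finite_ground] by blast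
  define F where "F = (`) g ` nonupper ` carrier L"
  interpret B: antimatroid "g ` meet_irreducibles" F
    unfolding F_def by (rule A.antimatroid_image[OF g])
  define f where "f x = g ` nonupper x" for x
  have sub: "f x \<subseteq> f y \<longleftrightarrow> x \<sqsubseteq> y" if "x \<in> carrier L" "y \<in> carrier L" for x y
  proof -
    have "f x \<subseteq> f y \<longleftrightarrow> g ` (nonupper x \<union> nonupper y) = g ` nonupper y"
      by (simp add: f_def image_Un subset_Un_eq)
    also have "\<dots> \<longleftrightarrow> nonupper x \<union> nonupper y = nonupper y"
      by (rule inj_on_image_eq_iff[OF g]) (auto simp: nonupper_def)
    also have "\<dots> \<longleftrightarrow> x \<sqsubseteq> y"
      using nonupper_subset_iff[OF that] by (simp add: subset_Un_eq)
    finally show ?thesis .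
  qed
  have "inj_on f (carrier L)"
  proof (rule inj_onI)
    fix x y assume "x \<in> carrier L" "y \<in> carrier L" "f x = f y"
    then show "x = y" using sub[of x y] sub[of y x] le_antisym[of x y] by simp
  qed
  then have "bij_betw f (carrier L) F"
    by (auto simp: bij_betw_def f_def F_def image_image)
  moreover have "order_emb L (inclusion_order F) f"
    unfolding order_emb_def
    using weak_partial_order_axioms B.feasible.weak_partial_order_axioms sub
    by (auto simp: inclusion_order_def f_def F_def)
  ultimately have "order_isomorphic L (rdp (g ` meet_irreducibles) B.depsets)"
    unfolding order_isomorphic_def B.rdp_depsets by (auto simp: inclusion_order_def)
  then show ?thesis using B.DSC_depsets by blast
qed

theorem corollary3p25:
  shows "(\<forall>(E :: 'e set) dep. DSC E dep \<longrightarrow>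
             finite_lattice (rdp E dep) \<and> diamond_free_semimodular (rdp E dep)) \<and>
         (\<forall>L :: ('a, 'c) gorder_scheme. finite_lattice L \<and> diamond_free_semimodular L \<longrightarrow>
             (\<exists>(E :: nat set) dep. DSC E dep \<and> order_isomorphic L (rdp E dep)))"
proof (intro conjI allI impI; (elim conjE)?)
  fix E :: "'e set" and dep assume "DSC E dep"
  then interpret DSC E dep .
  interpret antimatroid E "Collect (complete_subset E dep)" by (rule antimatroid_complete)
  show "finite_lattice (rdp E dep)" "diamond_free_semimodular (rdp E dep)"
    unfolding rdp_eq by (rule finite_lattice_feasible diamond_free_semimodular_feasible)+
next
  fix L :: "('a, 'c) gorder_scheme"
  assume "finite_lattice L" "diamond_free_semimodular L"
  then have "diamond_free_semimodular_lattice L"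
    unfolding finite_lattice_def diamond_free_semimodular_lattice_def finite_poset_def
      finite_poset_axioms_def diamond_free_semimodular_lattice_axioms_def
    by (auto dest: lattice.axioms(1) upper_semilattice.axioms(1))
  then show "\<exists>(E :: nat set) dep. DSC E dep \<and> order_isomorphic L (rdp E dep)"
    by (rule diamond_free_semimodular_lattice.represented_by_DSC)
qed

end
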